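(* Let $I$ be a translation-invariant $\sigma$-ideal on $\mathbb{R}$ (containing all singletons, not containing $\mathbb{R}$). If $I$ has property (M), then $I$ has property (M$^*$).
   Context: $I$ is translation invariant if $A\in I$ and $x\in\mathbb{R}$ imply $A+x\in I$. Property (M): there is a Borel function $f:\mathbb{R}\to\mathbb{R}$ with $f^{-1}[\{x\}]\notin I$ for every $x\in\mathbb{R}$. Property (M$^*$): there is a Borel function $f:\mathbb{R}\to\mathbb{R}$ such that $f^{-1}[\{x\}]\cap U\notin I$ for every $x\in\mathbb{R}$ and every nonempty open $U\subseteq\mathbb{R}$. *)

theory Defs
  imports "HOL-Analysis.Analysis"
begin

definition sigma_ideal_R :: "real set set \<Rightarrow> bool" where
  "sigma_ideal_R I \<longleftrightarrow>
     (\<forall>A B. A \<in> I \<longrightarrow> B \<subseteq> A \<longrightarrow> B \<in> I) \<and>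
     (\<forall>F :: nat \<Rightarrow> real set. (\<forall>n. F n \<in> I) \<longrightarrow> (\<Union>n. F n) \<in> I) \<and>
     (\<forall>x. {x} \<in> I) \<and>
     UNIV \<notin> I"

definition translation_invariant :: "real set set \<Rightarrow> bool" where
  "translation_invariant I \<longleftrightarrow> (\<forall>A \<in> I. \<forall>x. (\<lambda>a. a + x) ` A \<in> I)"

definition property_M :: "real set set \<Rightarrow> bool" where
  "property_M I \<longleftrightarrow>
     (\<exists>f :: real \<Rightarrow> real. f \<in> borel_measurable borel \<and> (\<forall>x. f -` {x} \<notin> I))"

definition property_M_star :: "real set set \<Rightarrow> bool" where
  "property_M_star I \<longleftrightarrow>
     (\<exists>f :: real \<Rightarrow> real. f \<in> borel_measurable borel \<and>
        (\<forall>x U. open U \<longrightarrow> U \<noteq> {} \<longrightarrow> f -` {x} \<inter> U \<notin> I))"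

end

theory Submission
  imports Defs
begin

text \<open>Let \<open>f\<close> witness (M), and let \<open>d 0, d 1, \<dots>\<close> be Borel functions that together form a surjection of the reals
  onto all real sequences. By the countable chain condition modulo meagre sets, some fibre of \<open>d 0 \<circ> f\<close>
  is meagre; cover it by closed nowhere dense sets \<open>C k\<close> of small diameter. A diagonal argument gives a \<open>k\<close>
  such that every fibre of \<open>d (Suc k) \<circ> f\<close> is positive on \<open>C k\<close>. By translation invariance such a closed
  nowhere dense set exists inside every nonempty open set, so one can choose disjoint ones inside the members
  of a countable base and glue the corresponding functions.\<close>

section \<open>Meagre sets and the Baire category theorem\<close>

text \<open>Asking for a cover by closed sets, not for equality with a union of nowhere dense sets,
  makes heredity immediate and later supplies the closed pieces.\<close>

definition meagre :: "'a::topological_space set \<Rightarrow> bool" where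
  "meagre S \<longleftrightarrow> (\<exists>C :: nat \<Rightarrow> 'a set. (\<forall>n. closed (C n) \<and> interior (C n) = {}) \<and> S \<subseteq> (\<Union>n. C n))"

lemma meagre_subset: "meagre T \<Longrightarrow> S \<subseteq> T \<Longrightarrow> meagre S"
  unfolding meagre_def by (meson subset_trans)

lemma meagre_nowhere_dense: "closed S \<Longrightarrow> interior S = {} \<Longrightarrow> meagre S"
  unfolding meagre_def by (intro exI[of _ "\<lambda>_. S"]) auto

lemma meagre_UN:
  fixes S :: "nat \<Rightarrow> 'a::topological_space set"
  assumes "\<And>n. meagre (S n)"
  shows "meagre (\<Union>n. S n)"
proof -
  obtain C :: "nat \<Rightarrow> nat \<Rightarrow> 'a set"
    where C: "\<And>n k. closed (C n k)" "\<And>n k. interior (C n k) = {}" "\<And>n. S n \<subseteq> (\<Union>k. C n k)"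
    using assms unfolding meagre_def by metis
  define D where "D m = (case prod_decode m of (n, k) \<Rightarrow> C n k)" for m
  have D: "closed (D m)" "interior (D m) = {}" for m
    by (simp_all add: D_def C(1,2) split: prod.split)
  have "(\<Union>n. S n) \<subseteq> (\<Union>m. D m)"
  proof
    fix x assume "x \<in> (\<Union>n. S n)"
    then obtain n k where "x \<in> C n k" using C(3) by blast
    then have "x \<in> D (prod_encode (n, k))" by (simp add: D_def)
    then show "x \<in> (\<Union>m. D m)" by blast
  qed
  with D show ?thesis unfolding meagre_def by blast
qed

lemma meagre_Un:
  assumes "meagre S" "meagre T"
  shows "meagre (S \<union> T)"
proof -
  have "meagre (\<Union>n::nat. if n = 0 then S else T)"
    using assms by (intro meagre_UN) auto
  moreover have "S \<union> T \<subseteq> (\<Union>n::nat. if n = 0 then S else T)"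
  proof
    fix x assume "x \<in> S \<union> T"
    then have "x \<in> (if (0::nat) = 0 then S else T) \<or> x \<in> (if (1::nat) = 0 then S else T)" by auto
    then show "x \<in> (\<Union>n::nat. if n = 0 then S else T)" by blast
  qed
  ultimately show ?thesis by (rule meagre_subset)
qed

text \<open>By the Baire category theorem the complements of the covering closed sets have dense
  intersection, and an open set missing a dense set is empty.\<close>

lemma open_meagre_empty:
  fixes U :: "'a::{real_normed_vector,heine_borel} set"
  assumes "open U" "meagre U"
  shows "U = {}"
proof -
  obtain C where C: "\<And>n::nat. closed (C n)" "\<And>n. interior (C n) = {}" "U \<subseteq> (\<Union>n. C n)"
    using assms(2) unfolding meagre_def by auto
  have "UNIV \<subseteq> closure (\<Inter>(range (\<lambda>n. - C n)))"
    by (rule Baire) (use C in \<open>auto simp: closure_complement open_Compl\<close>)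
  moreover have "U \<inter> \<Inter>(range (\<lambda>n. - C n)) = {}"
    using C(3) by auto
  ultimately show ?thesis
    using open_Int_closure_eq_empty[OF assms(1)] by auto
qed

section \<open>Baire property and fibres of Borel functions\<close>

definition baire_property :: "'a::topological_space set \<Rightarrow> bool" where
  "baire_property S \<longleftrightarrow> (\<exists>U. open U \<and> meagre (S - U \<union> (U - S)))"

text \<open>The complement is approximated by \<open>- closure U\<close>; the only new error is the
  boundary \<open>closure U - U\<close>, which is closed and nowhere dense.\<close>

lemma baire_property_Compl:
  assumes "baire_property S"
  shows "baire_property (- S)"
proof -
  obtain U where U: "open U" "meagre (S - U \<union> (U - S))"
    using assms unfolding baire_property_def by auto
  have "meagre (closure U - U)"
  proof (rule meagre_nowhere_dense)
    show "closed (closure U - U)" using U(1) by (simp add: closed_Diff)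
    show "interior (closure U - U) = {}"
    proof -
      have "interior (closure U - U) \<inter> U = {}" using interior_subset by auto
      then have "interior (closure U - U) \<inter> closure U = {}"
        using open_Int_closure_eq_empty[OF open_interior] by blast
      then show ?thesis using interior_subset[of "closure U - U"] by auto
    qed
  qed
  then have "meagre ((S - U \<union> (U - S)) \<union> (closure U - U))"
    by (rule meagre_Un[OF U(2)])
  then have "meagre (- S - - closure U \<union> (- closure U - - S))"
    by (rule meagre_subset) (use closure_subset in auto)
  then show ?thesis unfolding baire_property_def by (meson closed_closure open_Compl)
qed

lemma baire_property_UN:
  fixes S :: "nat \<Rightarrow> 'a::topological_space set"
  assumes "\<And>n. baire_property (S n)"
  shows "baire_property (\<Union>n. S n)"
proof -
  obtain U where U: "\<And>n. open (U n)" "\<And>n. meagre (S n - U n \<union> (U n - S n))"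
    using assms unfolding baire_property_def by metis
  have "meagre ((\<Union>n. S n) - (\<Union>n. U n) \<union> ((\<Union>n. U n) - (\<Union>n. S n)))"
    by (rule meagre_subset[OF meagre_UN[of "\<lambda>n. S n - U n \<union> (U n - S n)", OF U(2)]]) auto
  then show ?thesis unfolding baire_property_def using U(1) by blast
qed

lemma meagre_empty: "meagre {}"
  by (rule meagre_nowhere_dense) auto

lemma borel_baire_property:
  assumes "S \<in> sets borel"
  shows "baire_property S"
proof -
  have *: "baire_property U" if "open U" for U :: "'a set"
    using that unfolding baire_property_def by (intro exI[of _ U]) (simp add: meagre_empty)
  have "S \<in> sigma_sets UNIV {S. open S}" using assms by (simp add: sets_borel)
  then show ?thesis
    by (induction rule: sigma_sets.induct)
      (auto simp: Compl_eq_Diff_UNIV[symmetric] intro: * baire_property_Compl baire_property_UN)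
qed

text \<open>Were every fibre nonmeagre, the open sets approximating the fibres would be uncountably
  many disjoint nonempty sets, contrary to second countability.\<close>

lemma borel_function_meagre_fibre:
  fixes f :: "'a::{real_normed_vector,heine_borel,second_countable_topology} \<Rightarrow> real"
  assumes "f \<in> borel_measurable borel"
  shows "\<exists>y. meagre (f -` {y})"
proof (rule ccontr)
  assume nm: "\<nexists>y. meagre (f -` {y})"
  have "f -` {y} \<in> sets borel" for y
    using assms by (intro measurable_sets_borel[of f borel]) auto
  then have "\<forall>y. \<exists>U. open U \<and> meagre (f -` {y} - U \<union> (U - f -` {y}))"
    using borel_baire_property unfolding baire_property_def by blast
  then obtain U where U: "\<And>y. open (U y)" "\<And>y. meagre (f -` {y} - U y \<union> (U y - f -` {y}))"
    unfolding choice_iff by blast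
  have ne: "U y \<noteq> {}" for y
    using U(2)[of y] nm by auto
  have disj: "U y \<inter> U z = {}" if "y \<noteq> z" for y z
  proof (rule open_meagre_empty)
    show "open (U y \<inter> U z)" using U(1) by auto
    \<comment> \<open>A common point of \<open>U y\<close> and \<open>U z\<close> misses one of the
      two disjoint fibres, so it lies in one of the two meagre errors.\<close>
    show "meagre (U y \<inter> U z)"
      by (rule meagre_subset[OF meagre_Un[OF U(2)[of y] U(2)[of z]]]) (use that in auto)
  qed
  have "inj U" using ne disj by (metis Int_absorb injI)
  moreover have "countable (range U)"
  proof (rule countable_disjoint_open_subsets)
    show "pairwise disjnt (range U)"
      unfolding pairwise_def disjnt_def using disj by (metis rangeE)
  qed (use U(1) in auto)
  ultimately have "countable (UNIV :: real set)" by (metis countable_image_inj_on)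
  then show False using uncountable_UNIV_real by blast
qed

section \<open>Coding real sequences by single reals\<close>

text \<open>Base 4 rather than base 2, so that a digit sequence ending in ones is not carried over.\<close>

lemma exists_digits:
  fixes b :: "nat \<Rightarrow> bool"
  shows "\<exists>x::real. \<forall>n. odd \<lfloor>4 ^ (n + 1) * x\<rfloor> \<longleftrightarrow> b n"
proof -
  define t :: "nat \<Rightarrow> real" where "t n = of_bool (b n) / 4 ^ (n + 1)" for n
  have geo: "(\<lambda>i. (1/4::real) ^ (i + 1)) sums (1/3)"
    using sums_mult[OF geometric_sums[of "1/4::real"], of "1/4"] by simp
  have le: "t n \<le> (1/4) ^ (n + 1)" and pos: "0 \<le> t n" for n
    by (auto simp: t_def power_divide)
  have sum: "summable t"
    by (rule summable_comparison_test'[OF sums_summable[OF geo], of 0]) (use le pos in auto)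
  have "odd \<lfloor>4 ^ (n + 1) * suminf t\<rfloor> \<longleftrightarrow> b n" for n
  proof -
    \<comment> \<open>\<open>z\<close> is the integer formed by the digits up to place
      \<open>n\<close>; the scaled tail \<open>r\<close> lies between 0 and 1/3, so it does not
      change the floor.\<close>
    define z :: int where "z = (\<Sum>i\<le>n. of_bool (b i) * 4 ^ (n - i))"
    define r where "r = 4 ^ (n + 1) * (\<Sum>i. t (i + (n + 1)))"
    have "4 ^ (n + 1) * suminf t = 4 ^ (n + 1) * (\<Sum>i<n + 1. t i) + r"
      unfolding r_def using suminf_split_initial_segment[OF sum, of "n + 1"]
      by (simp add: algebra_simps)
    also have "4 ^ (n + 1) * (\<Sum>i<n + 1. t i) = of_int z"
      unfolding z_def t_def of_int_sum sum_distrib_left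
      by (rule sum.cong) (auto simp: lessThan_Suc_atMost power_add[symmetric] field_simps)
    finally have eq: "4 ^ (n + 1) * suminf t = of_int z + r" .
    have r: "r = (\<Sum>i. 4 ^ (n + 1) * t (i + (n + 1)))"
      unfolding r_def by (rule suminf_mult[symmetric]) (rule summable_ignore_initial_segment[OF sum])
    have le': "4 ^ (n + 1) * t (i + (n + 1)) \<le> (1/4) ^ (i + 1)" for i
      by (auto simp: t_def power_add power_divide)
    have sum': "summable (\<lambda>i. 4 ^ (n + 1) * t (i + (n + 1)))"
      by (rule summable_comparison_test'[OF sums_summable[OF geo], of 0]) (use le' pos in auto)
    have "r \<le> 1/3"
      unfolding r sums_unique[OF geo] by (rule suminf_le[OF le' sum' sums_summable[OF geo]])
    moreover have "0 \<le> r"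
      unfolding r by (rule suminf_nonneg[OF sum']) (use pos in auto)
    ultimately have "\<lfloor>4 ^ (n + 1) * suminf t\<rfloor> = z"
      unfolding eq by linarith
    moreover have "odd z \<longleftrightarrow> b n"
    proof -
      \<comment> \<open>Modulo 2 only the last digit survives, since every earlier one is multiplied
        by a positive power of 4.\<close>
      have "z = (\<Sum>i<n. of_bool (b i) * 4 ^ (n - i)) + of_bool (b n)"
        unfolding z_def by (simp flip: lessThan_Suc_atMost)
      moreover have "even (\<Sum>i<n. of_bool (b i) * 4 ^ (n - i) :: int)"
        by (rule dvd_sum) auto
      ultimately show ?thesis by auto
    qed
    ultimately show ?thesis by simp
  qed
  then show ?thesis by blast
qed

text \<open>A real \<open>y\<close> is coded by the set of indices of the rationals below it.\<close>

lemma borel_sequence_coordinates: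
  "\<exists>d :: nat \<Rightarrow> real \<Rightarrow> real. (\<forall>k. d k \<in> borel_measurable borel) \<and> (\<forall>y. \<exists>x. \<forall>k. d k x = y k)"
proof -
  define q :: "nat \<Rightarrow> real" where "q = from_nat_into \<rat>"
  have range_q: "range q = \<rat>"
    unfolding q_def by (rule range_from_nat_into) (auto simp: countable_rat)
  \<comment> \<open>The digits with index \<open>prod_encode (k, n)\<close> form the
    \<open>k\<close>-th code. An index outside the code contributes \<open>-\<infinity>\<close>,
    which is neutral for the supremum; infinite suprema are sent to 0 by
    \<open>real_of_ereal\<close>.\<close>
  define d :: "nat \<Rightarrow> real \<Rightarrow> real" where
    "d k x = real_of_ereal (SUP n. if odd \<lfloor>4 ^ (prod_encode (k, n) + 1) * x\<rfloor> then ereal (q n) else -\<infinity>)"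
    for k x
  have "d k \<in> borel_measurable borel" for k
    unfolding d_def by measurable
  moreover have "\<exists>x. \<forall>k. d k x = y k" for y
  proof -
    obtain x :: real where x: "\<And>m. odd \<lfloor>4 ^ (m + 1) * x\<rfloor> \<longleftrightarrow> (case prod_decode m of (k, n) \<Rightarrow> q n < y k)"
      using exists_digits[of "\<lambda>m. case prod_decode m of (k, n) \<Rightarrow> q n < y k"] by auto
    have "(SUP n. if q n < y k then ereal (q n) else -\<infinity>) = ereal (y k)" for k
    proof (rule SUP_eqI)
      fix c :: ereal
      assume c: "\<And>n. n \<in> UNIV \<Longrightarrow> (if q n < y k then ereal (q n) else -\<infinity>) \<le> c"
      show "ereal (y k) \<le> c"
      proof (rule ccontr)
        assume "\<not> ereal (y k) \<le> c"
        then obtain s where s: "c < ereal s" "s < y k"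
          using ereal_dense2[of c "ereal (y k)"] by (auto simp: not_le)
        obtain p where "p \<in> \<rat>" "s < p" "p < y k" using Rats_dense_in_real[OF s(2)] by blast
        moreover obtain n where "p = q n" using \<open>p \<in> \<rat>\<close> range_q by blast
        ultimately have "ereal p \<le> c" using c[of n] by simp
        then show False using s(1) \<open>s < p\<close> by (metis ereal_less(2) leD less_ereal.simps(1) less_trans)
      qed
    qed auto
    then have "\<forall>k. d k x = y k" unfolding d_def x by simp
    then show ?thesis by blast
  qed
  ultimately show ?thesis by blast
qed

section \<open>Positive closed nowhere dense sets from property (M)\<close>

lemma sigma_ideal_R_subset: "sigma_ideal_R I \<Longrightarrow> A \<in> I \<Longrightarrow> B \<subseteq> A \<Longrightarrow> B \<in> I"
  unfolding sigma_ideal_R_def by blast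

lemma sigma_ideal_R_UN: "sigma_ideal_R I \<Longrightarrow> (\<And>n::nat. F n \<in> I) \<Longrightarrow> (\<Union>n. F n) \<in> I"
  unfolding sigma_ideal_R_def by blast

text \<open>Diagonal argument: if for each piece \<open>C k\<close> the function \<open>d (Suc k) \<circ> f\<close> had a small fibre over some
  \<open>y k\<close>, then the fibre of \<open>f\<close> over a point with coordinates \<open>y0, y 0, y 1, \<dots>\<close> would be small.\<close>

lemma property_M_small_nowhere_dense:
  assumes I: "sigma_ideal_R I" and M: "property_M I" and "0 < e"
  obtains N and h :: "real \<Rightarrow> real" and v where "closed N" "interior N = {}" "N \<subseteq> cball v e"
    "h \<in> borel_measurable borel" "\<And>y. h -` {y} \<inter> N \<notin> I"
proof -
  obtain f :: "real \<Rightarrow> real" where f[measurable]: "f \<in> borel_measurable borel" and fI: "\<And>x. f -` {x} \<notin> I"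
    using M unfolding property_M_def by blast
  obtain d :: "nat \<Rightarrow> real \<Rightarrow> real"
    where d[measurable]: "\<And>k. d k \<in> borel_measurable borel" and surj: "\<And>y. \<exists>x. \<forall>k. d k x = y k"
    using borel_sequence_coordinates by blast
  have meas: "(\<lambda>t. d k (f t)) \<in> borel_measurable borel" for k by measurable
  obtain y0 where "meagre ((\<lambda>t. d 0 (f t)) -` {y0})"
    using borel_function_meagre_fibre[OF meas] by blast
  then obtain M where M: "\<And>n::nat. closed (M n)" "\<And>n. interior (M n) = {}"
      "(\<lambda>t. d 0 (f t)) -` {y0} \<subseteq> (\<Union>n. M n)"
    unfolding meagre_def by auto
  define q :: "nat \<Rightarrow> real" where "q = from_nat_into \<rat>"
  have range_q: "range q = \<rat>"
    unfolding q_def by (rule range_from_nat_into) (auto simp: countable_rat)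
  \<comment> \<open>Balls of radius \<open>e\<close> about the rationals cover the line; cutting
    with them keeps each piece small enough to be translated into a given ball later.\<close>
  define C where "C k = (case prod_decode k of (i, j) \<Rightarrow> M i \<inter> cball (q j) e)" for k
  have cover: "t \<in> (\<Union>k. C k)" if "d 0 (f t) = y0" for t
  proof -
    have "t \<in> (\<lambda>t. d 0 (f t)) -` {y0}" using that by simp
    then obtain i where i: "t \<in> M i" using M(3) by blast
    obtain p where "p \<in> \<rat>" "t < p" "p < t + e" using Rats_dense_in_real[of t "t + e"] \<open>0 < e\<close> by auto
    moreover obtain j where "p = q j" using \<open>p \<in> \<rat>\<close> range_q by blast
    ultimately have "t \<in> C (prod_encode (i, j))" using i by (simp add: C_def dist_real_def)
    then show ?thesis by blast
  qed
  have "\<exists>k. \<forall>y. (\<lambda>t. d (Suc k) (f t)) -` {y} \<inter> C k \<notin> I"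
  proof (rule ccontr)
    assume "\<not> ?thesis"
    then obtain y where y: "\<And>k. (\<lambda>t. d (Suc k) (f t)) -` {y k} \<inter> C k \<in> I" by metis
    obtain x where x: "\<And>k. d k x = (case k of 0 \<Rightarrow> y0 | Suc k \<Rightarrow> y k)" using surj by blast
    \<comment> \<open>Coordinate 0 of \<open>x\<close> puts a point of the fibre into some
      \<open>C k\<close>; coordinate \<open>Suc k\<close> then puts it into the small set chosen for
      that \<open>k\<close>.\<close>
    have "f -` {x} \<subseteq> (\<Union>k. (\<lambda>t. d (Suc k) (f t)) -` {y k} \<inter> C k)"
    proof
      fix t assume "t \<in> f -` {x}"
      then have ft: "f t = x" by simp
      then obtain k where "t \<in> C k" using cover[of t] x[of 0] by auto
      then show "t \<in> (\<Union>k. (\<lambda>t. d (Suc k) (f t)) -` {y k} \<inter> C k)" using ft x[of "Suc k"] by auto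
    qed
    then have "f -` {x} \<in> I"
      by (rule sigma_ideal_R_subset[OF I sigma_ideal_R_UN[OF I y]])
    with fI show False by blast
  qed
  then obtain k where k: "\<And>y. (\<lambda>t. d (Suc k) (f t)) -` {y} \<inter> C k \<notin> I" by blast
  obtain i j where ij: "prod_decode k = (i, j)" by fastforce
  show thesis
  proof (rule that[OF _ _ _ meas k])
    show "closed (C k)" by (simp add: C_def ij M closed_Int)
    show "interior (C k) = {}" by (simp add: C_def ij M)
    show "C k \<subseteq> cball (q j) e" by (simp add: C_def ij)
  qed
qed

text \<open>A small positive set in a ball of radius \<open>e\<close> is moved, together with its
  function, into a ball of the same radius inside \<open>V\<close>; translating a fibre back by
  \<open>v - c\<close> shows that it stays positive.\<close>

lemma property_M_nowhere_dense_in_open: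
  assumes I: "sigma_ideal_R I" and T: "translation_invariant I" and M: "property_M I"
    and V: "open V" "V \<noteq> {}"
  obtains N and h :: "real \<Rightarrow> real" where "closed N" "interior N = {}" "N \<subseteq> V"
    "h \<in> borel_measurable borel" "\<And>y. h -` {y} \<inter> N \<notin> I"
proof -
  obtain c e where e: "0 < e" "cball c e \<subseteq> V" using V open_contains_cball by blast
  obtain N and h :: "real \<Rightarrow> real" and v where N: "closed N" "interior N = {}" "N \<subseteq> cball v e"
    and h[measurable]: "h \<in> borel_measurable borel" and hI: "\<And>y. h -` {y} \<inter> N \<notin> I"
    by (rule property_M_small_nowhere_dense[OF I M e(1)]) (rule that)
  let ?N = "(+) (c - v) ` N" and ?h = "\<lambda>t. h (t - (c - v))"
  show thesis
  proof (rule that)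
    show "closed ?N" using N(1) by (rule closed_translation)
    show "interior ?N = {}" by (simp add: interior_translation N(2))
    have "?N \<subseteq> cball c e"
    proof
      fix x assume "x \<in> ?N"
      then obtain t where "x = c - v + t" "t \<in> cball v e" using N(3) by blast
      then show "x \<in> cball c e" by (simp add: dist_real_def)
    qed
    then show "?N \<subseteq> V" using e(2) by blast
    show "?h \<in> borel_measurable borel" by measurable
    show "?h -` {y} \<inter> ?N \<notin> I" for y
    proof
      assume "?h -` {y} \<inter> ?N \<in> I"
      then have "(\<lambda>a. a + (v - c)) ` (?h -` {y} \<inter> ?N) \<in> I"
        using T unfolding translation_invariant_def by blast
      moreover have "h -` {y} \<inter> N \<subseteq> (\<lambda>a. a + (v - c)) ` (?h -` {y} \<inter> ?N)"
      proof
        fix t assume "t \<in> h -` {y} \<inter> N"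
        then show "t \<in> (\<lambda>a. a + (v - c)) ` (?h -` {y} \<inter> ?N)"
          by (intro image_eqI[of _ _ "c - v + t"]) auto
      qed
      ultimately show False using hI sigma_ideal_R_subset[OF I] by blast
    qed
  qed
qed

section \<open>Gluing disjoint pieces along a countable base\<close>

theorem theorem6p2:
  fixes I :: "real set set"
  assumes "sigma_ideal_R I"
    and "translation_invariant I"
    and "property_M I"
  shows "property_M_star I"
proof -
  obtain \<B> :: "real set set" where \<B>: "countable \<B>" "topological_basis \<B>"
    using ex_countable_basis by blast
  define B where "B = from_nat_into (\<B> - {{}})"
  have nonempty: "\<B> - {{}} \<noteq> {}"
    using topological_basisE[OF \<B>(2) open_UNIV UNIV_I[of "0::real"]] by blast
  have range_B: "range B = \<B> - {{}}"
    unfolding B_def by (rule range_from_nat_into) (use nonempty \<B>(1) in auto)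
  have B: "open (B n)" "B n \<noteq> {}" for n
    using range_B topological_basis_open[OF \<B>(2)] by blast+
  \<comment> \<open>In a state \<open>(D, N, h)\<close>, \<open>N\<close> is the new piece with its
    function \<open>h\<close>, and \<open>D\<close> is a closed nowhere dense set holding all pieces
    so far; \<open>Q\<close> makes the next piece avoid it.\<close>
  define P where "P n s \<longleftrightarrow> (case s of (D, N, h) \<Rightarrow>
      closed D \<and> interior D = {} \<and> N \<subseteq> D \<and> N \<subseteq> B n \<and> closed N \<and>
      h \<in> borel_measurable borel \<and> (\<forall>y. h -` {y} \<inter> N \<notin> I))"
    for n and s :: "real set \<times> real set \<times> (real \<Rightarrow> real)"
  define Q where "Q s s' \<longleftrightarrow> fst s \<subseteq> fst s' \<and> fst s \<inter> fst (snd s') = {}"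
    for s s' :: "real set \<times> real set \<times> (real \<Rightarrow> real)"
  have "\<exists>s. P 0 s"
  proof -
    obtain N and h :: "real \<Rightarrow> real" where "closed N" "interior N = {}" "N \<subseteq> B 0"
      "h \<in> borel_measurable borel" "\<And>y. h -` {y} \<inter> N \<notin> I"
      by (rule property_M_nowhere_dense_in_open[OF assms B]) (rule that)
    then have "P 0 (N, N, h)" by (simp add: P_def)
    then show ?thesis by blast
  qed
  moreover have "\<exists>s'. P (Suc n) s' \<and> Q s s'" if "P n s" for n s
  proof -
    have D: "closed (fst s)" "interior (fst s) = {}" using that by (auto simp: P_def)
    \<comment> \<open>A closed set with empty interior cannot exhaust a nonempty open set, so there
      is room for the next piece.\<close>
    have "open (B (Suc n) - fst s)" using B D by (simp add: open_Diff)
    moreover have "B (Suc n) - fst s \<noteq> {}"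
      using interior_maximal[of "B (Suc n)" "fst s"] B D by blast
    ultimately obtain N and h :: "real \<Rightarrow> real" where
      "closed N" "interior N = {}" "N \<subseteq> B (Suc n) - fst s" "h \<in> borel_measurable borel" "\<And>y. h -` {y} \<inter> N \<notin> I"
      by (rule property_M_nowhere_dense_in_open[OF assms]) (rule that)
    with D have "P (Suc n) (fst s \<union> N, N, h)" "Q s (fst s \<union> N, N, h)"
      by (auto simp: P_def Q_def interior_closed_Un_empty_interior)
    then show ?thesis by metis
  qed
  ultimately have "\<exists>s. \<forall>n. P n (s n) \<and> Q (s n) (s (Suc n))"
    by (rule dependent_nat_choice)
  then obtain s where P: "\<And>n. P n (s n)" and Q: "\<And>n. Q (s n) (s (Suc n))"
    by blast
  define D N h where "D n = fst (s n)" and "N n = fst (snd (s n))" and "h n = snd (snd (s n))" for n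
  have N: "N n \<subseteq> D n" "N n \<subseteq> B n" "closed (N n)" "\<And>y. h n -` {y} \<inter> N n \<notin> I"
    and h: "h n \<in> borel_measurable borel" for n
    using P[of n] by (auto simp: P_def D_def N_def h_def split: prod.splits)
  have DQ: "D n \<subseteq> D (Suc n)" "D n \<inter> N (Suc n) = {}" for n
    using Q[of n] by (auto simp: Q_def D_def N_def)
  have disj: "N m \<inter> N n = {}" if "m < n" for m n
  proof -
    obtain n' where n': "n = Suc n'" "m \<le> n'" using \<open>m < n\<close> by (cases n) auto
    have "N m \<subseteq> D n'" using lift_Suc_mono_le[of D, OF DQ(1) n'(2)] N(1) by blast
    then show ?thesis using DQ(2)[of n'] n'(1) by blast
  qed
  \<comment> \<open>By disjointness the index is the only possible one on each \<open>N n\<close>.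
    Off all pieces \<open>LEAST\<close> yields one fixed unspecified number, so \<open>g\<close> is
    still Borel.\<close>
  define g where "g t = h (LEAST n. t \<in> N n) t" for t
  have "Measurable.pred borel (\<lambda>t. t \<in> N n)" for n
    using N(3) by (intro pred_sets2[of _ borel]) auto
  then have g: "g \<in> borel_measurable borel"
    unfolding g_def by (rule measurable_compose_countable[OF h measurable_Least])
  have g_eq: "g t = h n t" if "t \<in> N n" for t n
  proof -
    have "(LEAST n. t \<in> N n) = n"
    proof (rule Least_equality)
      show "t \<in> N n" by (rule that)
      show "n \<le> k" if "t \<in> N k" for k
        using disj[of k n] \<open>t \<in> N n\<close> that by (meson disjoint_iff not_le)
    qed
    then show ?thesis by (simp add: g_def)
  qed
  have "g -` {y} \<inter> U \<notin> I" if U: "open U" "U \<noteq> {}" for y U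
  proof
    assume gI: "g -` {y} \<inter> U \<in> I"
    obtain x where "x \<in> U" using U(2) by blast
    then obtain b where "b \<in> \<B>" "x \<in> b" "b \<subseteq> U"
      by (rule topological_basisE[OF \<B>(2) U(1)])
    \<comment> \<open>A basic set inside \<open>U\<close> brings its whole piece \<open>N n\<close>
      with it, where \<open>g\<close> agrees with \<open>h n\<close> and so has positive
      fibres.\<close>
    then obtain n where "B n \<subseteq> U" using range_B by (metis DiffI empty_iff rangeE singletonD)
    then have "h n -` {y} \<inter> N n \<subseteq> g -` {y} \<inter> U" using N(2)[of n] g_eq by auto
    then have "h n -` {y} \<inter> N n \<in> I" by (rule sigma_ideal_R_subset[OF assms(1) gI])
    with N(4) show False by blast
  qed
  then show ?thesis unfolding property_M_star_def using g by blast
qed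

end
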